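(* Let $k\geq 3$ be an integer, and let $G$ be a connected weak $k$-bicritical graph. If $G$ has a diametrical vertex $x$ such that $\bigcup_{1\leq i\leq 3}N^{(i)}_G(x)\subseteq V^{-}(G)$ and $|N^{(2)}_G(x)|\geq 2$, then $\operatorname{diam}(G)\leq 2k-3$.
   Context: All graphs are finite, simple and undirected. $\gamma(G)$ denotes the domination number. Define $V^{0}(G)=\{v:\gamma(G-v)=\gamma(G)\}$, $V^{+}(G)=\{v:\gamma(G-v)>\gamma(G)\}$, $V^{-}(G)=\{v:\gamma(G-v)<\gamma(G)\}$. A graph is critical if $V(G)=V^{-}(G)$. $G$ is weak bicritical if $V^{+}(G)=\emptyset$ and $G-v$ is critical for every $v\in V^{0}(G)$; weak $k$-bicritical if in addition $\gamma(G)=k$. For a vertex $x$ and integer $i\geq 0$, $N^{(i)}_G(x)=\{y: d_G(x,y)=i\}$. A vertex $x$ is diametrical if $\max_y d_G(x,y)=\operatorname{diam}(G)$. *)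

theory Defs
  imports "Graph_Theory.Graph_Theory"
begin

text \<open>
  A finite, simple, undirected graph is an instance of the locale \<^locale>\<open>graph\<close>: a finite
  symmetric digraph without loops and parallel arcs. Hence \<open>u \<rightarrow>\<^bsub>G\<^esub> v\<close> is the (symmetric)
  adjacency relation, and \<^const>\<open>pre_digraph.del_vert\<close> is the vertex-deleted subgraph.
\<close>

definition dominating_set :: "('a, 'b) pre_digraph \<Rightarrow> 'a set \<Rightarrow> bool" where
  "dominating_set G D \<longleftrightarrow>
     D \<subseteq> verts G \<and> (\<forall>v \<in> verts G - D. \<exists>u \<in> D. u \<rightarrow>\<^bsub>G\<^esub> v)"

text \<open>The null graph has domination number \<open>0\<close>; it occurs as \<open>K\<^sub>1 - v\<close>.\<close>

definition domination_number :: "('a, 'b) pre_digraph \<Rightarrow> nat" where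
  "domination_number G = Min (card ` {D. dominating_set G D})"

definition V_zero :: "('a, 'b) pre_digraph \<Rightarrow> 'a set" where
  "V_zero G =
     {v \<in> verts G. domination_number (pre_digraph.del_vert G v) = domination_number G}"

definition V_plus :: "('a, 'b) pre_digraph \<Rightarrow> 'a set" where
  "V_plus G =
     {v \<in> verts G. domination_number (pre_digraph.del_vert G v) > domination_number G}"

definition V_minus :: "('a, 'b) pre_digraph \<Rightarrow> 'a set" where
  "V_minus G =
     {v \<in> verts G. domination_number (pre_digraph.del_vert G v) < domination_number G}"

definition critical :: "('a, 'b) pre_digraph \<Rightarrow> bool" where
  "critical G \<longleftrightarrow> verts G = V_minus G"

definition weak_bicritical :: "('a, 'b) pre_digraph \<Rightarrow> bool" where
  "weak_bicritical G \<longleftrightarrow>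
     V_plus G = {} \<and> (\<forall>v \<in> V_zero G. critical (pre_digraph.del_vert G v))"

definition weak_k_bicritical :: "nat \<Rightarrow> ('a, 'b) pre_digraph \<Rightarrow> bool" where
  "weak_k_bicritical k G \<longleftrightarrow> weak_bicritical G \<and> domination_number G = k"

text \<open>
  The distance is the least cost of a walk when every arc has cost \<open>1\<close>, with value \<open>\<infinity>\<close> if there
  is no walk. The suprema below range over finite sets; for nonempty graphs they are maxima.
\<close>

definition graph_dist :: "('a, 'b) pre_digraph \<Rightarrow> 'a \<Rightarrow> 'a \<Rightarrow> ereal" where
  "graph_dist G u v = wf_digraph.\<mu> G (\<lambda>_. 1) u v"

definition dist_layer :: "('a, 'b) pre_digraph \<Rightarrow> nat \<Rightarrow> 'a \<Rightarrow> 'a set" where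
  "dist_layer G i x = {y \<in> verts G. graph_dist G x y = ereal (real i)}"

definition graph_diam :: "('a, 'b) pre_digraph \<Rightarrow> ereal" where
  "graph_diam G = (SUP u \<in> verts G. SUP v \<in> verts G. graph_dist G u v)"

definition diametrical :: "('a, 'b) pre_digraph \<Rightarrow> 'a \<Rightarrow> bool" where
  "diametrical G x \<longleftrightarrow>
     x \<in> verts G \<and> (SUP y \<in> verts G. graph_dist G x y) = graph_diam G"

end

theory Submission
  imports Defs
begin

text \<open>
  Let \<open>B\<^sub>j\<close> be the ball of radius \<open>j\<close> around \<open>x\<close>. Call a set \<open>S\<close> of fewer than \<open>k\<close> vertices
  \<open>j\<close>-sufficient if it dominates everything outside \<open>B\<^sub>j\<^sub>+\<^sub>1\<close> and \<open>2 |S \<inter> B\<^sub>j| \<ge> j + 2\<close>. If \<open>S\<close> is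
  \<open>j\<close>-sufficient but not \<open>(j + 2)\<close>-sufficient, then \<open>S\<close> avoids the layers \<open>j + 1\<close> and \<open>j + 2\<close>;
  delete a vertex \<open>v\<close> of layer \<open>j + 2\<close>, and if \<open>v\<close> is not critical also a vertex of layer \<open>j + 3\<close>,
  and let \<open>S'\<close> be a set of fewer than \<open>k\<close> vertices dominating the rest. Unless \<open>S'\<close> is
  \<open>(j + 2)\<close>-sufficient, the set \<open>(S' \<inter> B\<^sub>j\<^sub>+\<^sub>2) \<union> (S - B\<^sub>j\<^sub>+\<^sub>2)\<close> dominates the graph and is too small.
  Hence a \<open>j\<close>-sufficient set can be pushed outwards until \<open>j \<ge> d - 1\<close>, which gives
  \<open>d + 1 \<le> 2 (k - 1)\<close> for every vertex at distance \<open>d\<close> from \<open>x\<close>. The hypotheses on the first three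
  layers provide a sufficient set to start from.
\<close>

section \<open>Domination in a graph divided into levels\<close>

definition dominates_on :: "('a \<Rightarrow> 'a \<Rightarrow> bool) \<Rightarrow> 'a set \<Rightarrow> 'a set \<Rightarrow> bool" where
  "dominates_on E D W \<longleftrightarrow> (\<forall>w \<in> W. w \<in> D \<or> (\<exists>u \<in> D. E u w))"

lemma dominates_onD: "dominates_on E D W \<Longrightarrow> w \<in> W \<Longrightarrow> w \<in> D \<or> (\<exists>u \<in> D. E u w)"
  unfolding dominates_on_def by (rule bspec)

lemma dominates_on_subset: "dominates_on E D W \<Longrightarrow> W' \<subseteq> W \<Longrightarrow> dominates_on E D W'"
  unfolding dominates_on_def by blast

text \<open>Isolates what the counting needs: \<open>l\<close> stands for the distance from
  \<open>x\<close>, \<open>d\<close> for the distance of a chosen vertex, and \<open>k\<close> for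
  the domination number as a lower bound.\<close>

locale layered_graph =
  fixes V :: "'a set" and E :: "'a \<Rightarrow> 'a \<Rightarrow> bool" and l :: "'a \<Rightarrow> nat"
    and x :: 'a and d k :: nat
  assumes finite_V: "finite V"
    and sym: "E u v \<Longrightarrow> E v u"
    and level_step: "E u v \<Longrightarrow> l v \<le> Suc (l u)"
    and root_in: "x \<in> V"
    and level_0: "v \<in> V \<Longrightarrow> l v = 0 \<longleftrightarrow> v = x"
    and level_1: "v \<in> V \<Longrightarrow> l v = 1 \<Longrightarrow> E x v"
    and level_ex: "i \<le> d \<Longrightarrow> \<exists>v \<in> V. l v = i"
    and dominates_card: "D \<subseteq> V \<Longrightarrow> dominates_on E D V \<Longrightarrow> k \<le> card D"
begin

definition level_ball :: "nat \<Rightarrow> 'a set" where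
  "level_ball j = {v \<in> V. l v \<le> j}"

definition critical_vertex :: "'a \<Rightarrow> bool" where
  "critical_vertex v \<longleftrightarrow> (\<exists>S \<subseteq> V. card S < k \<and> dominates_on E S (V - {v}))"

text \<open>What criticality of \<open>u\<close> in the graph without \<open>v\<close> provides when
  deleting \<open>v\<close> leaves the domination number at \<open>k\<close>.\<close>

definition bicritical_pair :: "'a \<Rightarrow> 'a \<Rightarrow> bool" where
  "bicritical_pair v u \<longleftrightarrow> (\<exists>S \<subseteq> V. card S < k \<and> dominates_on E S (V - {v, u}))"

definition sufficient :: "nat \<Rightarrow> 'a set \<Rightarrow> bool" where
  "sufficient j S \<longleftrightarrow> S \<subseteq> V \<and> card S < k \<and> dominates_on E S (V - level_ball (Suc j)) \<and>
     j + 2 \<le> 2 * card (S \<inter> level_ball j)"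

lemma dominates_on_outside_level_ballI:
  assumes "\<And>w. w \<in> V \<Longrightarrow> j < l w \<Longrightarrow> w \<in> D \<or> (\<exists>u \<in> D. E u w)"
  shows "dominates_on E D (V - level_ball j)"
  unfolding dominates_on_def level_ball_def
proof
  fix w assume "w \<in> V - {v \<in> V. l v \<le> j}"
  then have "w \<in> V" "j < l w" by auto
  then show "w \<in> D \<or> (\<exists>u \<in> D. E u w)" by (rule assms)
qed

lemma card_split:
  assumes "S \<subseteq> V"
  shows "card S = card (S \<inter> level_ball j) + card (S - level_ball j)"
proof -
  have "finite S" using assms finite_V finite_subset by blast
  then show ?thesis by (rule card_Int_Diff)
qed

lemma level_step': "E u v \<Longrightarrow> l u \<le> Suc (l v)"
  by (rule level_step[OF sym])

lemma exchange:
  assumes S: "S \<subseteq> V" "card S < k" and S': "S' \<subseteq> V"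
    and le: "card (S' \<inter> level_ball j) \<le> card (S \<inter> level_ball j)"
  shows "\<not> dominates_on E ((S' \<inter> level_ball j) \<union> (S - level_ball j)) V"
proof
  assume "dominates_on E ((S' \<inter> level_ball j) \<union> (S - level_ball j)) V"
  then have "k \<le> card ((S' \<inter> level_ball j) \<union> (S - level_ball j))"
    using S S' by (intro dominates_card) auto
  also have "\<dots> \<le> card (S' \<inter> level_ball j) + card (S - level_ball j)" by (rule card_Un_le)
  also have "\<dots> \<le> card S" using le card_split[OF S(1), of j] by simp
  finally show False using S by simp
qed

text \<open>If \<open>S\<close> contained \<open>v\<close> or a neighbour of \<open>v\<close>, it
  would dominate \<open>V\<close> with fewer than \<open>k\<close> vertices.\<close>

lemma critical_witness:
  assumes "critical_vertex v" "v \<in> V"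
  obtains S where "S \<subseteq> V" "card S < k" "dominates_on E S (V - {v})"
    "v \<notin> S" "\<forall>u \<in> S. \<not> E u v"
proof -
  obtain S where S: "S \<subseteq> V" "card S < k" "dominates_on E S (V - {v})"
    using assms unfolding critical_vertex_def by blast
  have "\<not> dominates_on E S V" using dominates_card[of S] S by auto
  then show ?thesis using that[of S] S unfolding dominates_on_def by blast
qed

section \<open>Moving a sufficient set outwards, and finding one to start from\<close>

lemma sufficient_step:
  assumes suff: "sufficient j S" and jd: "j + 2 \<le> d"
    and weak: "\<And>v u. v \<in> V \<Longrightarrow> u \<in> V \<Longrightarrow> u \<noteq> v \<Longrightarrow> critical_vertex v \<or> bicritical_pair v u"
  shows "\<exists>S'. sufficient (j + 2) S'"
proof (rule ccontr)
  assume none: "\<nexists>S'. sufficient (j + 2) S'"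
  have S: "S \<subseteq> V" "card S < k" "2 * card (S \<inter> level_ball j) \<ge> j + 2"
    and domS: "\<And>w. w \<in> V \<Longrightarrow> l w \<ge> j + 2 \<Longrightarrow> w \<in> S \<or> (\<exists>u \<in> S. E u w)"
    using suff unfolding sufficient_def dominates_on_def level_ball_def by auto
  have fin: "finite S" using S finite_V finite_subset by blast
  have "dominates_on E S (V - level_ball (Suc (j + 2)))"
    using domS by (intro dominates_on_outside_level_ballI) simp
  then have small: "2 * card (S \<inter> level_ball (j + 2)) < j + 4"
    using none S unfolding sufficient_def by force
  \<comment> \<open>Twice the count is at least \<open>j + 2\<close> in the small ball and below
    \<open>j + 4\<close> in the large one, so no vertex is gained.\<close>
  have "S \<inter> level_ball j = S \<inter> level_ball (j + 2)"
  proof (rule card_seteq)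
    show "S \<inter> level_ball j \<subseteq> S \<inter> level_ball (j + 2)" unfolding level_ball_def by auto
    show "card (S \<inter> level_ball (j + 2)) \<le> card (S \<inter> level_ball j)" using small S by linarith
  qed (use fin in simp)
  then have gap: "l w \<le> j \<or> l w > j + 2" if "w \<in> S" for w
    using that S(1) unfolding level_ball_def by force
  obtain v where v: "v \<in> V" "l v = j + 2" using level_ex[OF jd] by blast
  \<comment> \<open>By \<open>gap\<close>, \<open>v\<close> is not in \<open>S\<close> and its
    dominator \<open>u\<close> can only lie in layer \<open>j + 3\<close>, still inside the ball
    beyond which domination is demanded.\<close>
  obtain u where u: "u \<in> S" "E u v" using domS[OF v(1)] v gap[of v] by auto
  have lu: "l u = j + 3" using gap[OF u(1)] level_step[OF u(2)] level_step'[OF u(2)] v by auto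
  have "critical_vertex v \<or> bicritical_pair v u"
    using weak[of v u] u v lu S(1) by force
  then obtain S' where S': "S' \<subseteq> V" "card S' < k"
    and domS': "\<And>w. w \<in> V \<Longrightarrow> w \<noteq> v \<Longrightarrow> w \<noteq> u \<Longrightarrow> w \<in> S' \<or> (\<exists>u \<in> S'. E u w)"
    unfolding critical_vertex_def bicritical_pair_def dominates_on_def by blast
  have "dominates_on E S' (V - level_ball (Suc (j + 2)))"
    using lu v by (intro dominates_on_outside_level_ballI domS') auto
  then have "2 * card (S' \<inter> level_ball (j + 2)) < j + 4"
    using none S' unfolding sufficient_def by force
  then have le: "card (S' \<inter> level_ball (j + 2)) \<le> card (S \<inter> level_ball (j + 2))"
    using S \<open>S \<inter> level_ball j = S \<inter> level_ball (j + 2)\<close> by simp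
  have "dominates_on E ((S' \<inter> level_ball (j + 2)) \<union> (S - level_ball (j + 2))) V"
    unfolding dominates_on_def
  proof
    fix w assume w: "w \<in> V"
    \<comment> \<open>Up to level \<open>j + 1\<close>, dominators in \<open>S'\<close> stay inside
      the ball; from level \<open>j + 2\<close> on, \<open>gap\<close> forces those in
      \<open>S\<close> outside it. So \<open>v\<close> and \<open>u\<close> are covered by
      \<open>S\<close>.\<close>
    show "w \<in> (S' \<inter> level_ball (j + 2)) \<union> (S - level_ball (j + 2)) \<or>
      (\<exists>u \<in> (S' \<inter> level_ball (j + 2)) \<union> (S - level_ball (j + 2)). E u w)"
    proof (cases "l w \<le> j + 1")
      case True
      then have "w \<noteq> v" "w \<noteq> u" using v lu by auto
      then have "w \<in> S' \<or> (\<exists>u \<in> S'. E u w)" by (rule domS'[OF w])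
      moreover have "l z \<le> j + 2" if "E z w" for z using level_step'[OF that] True by simp
      ultimately show ?thesis using True w S'(1) unfolding level_ball_def by auto
    next
      case False
      then have "w \<in> S \<or> (\<exists>u \<in> S. E u w)" by (intro domS[OF w]) simp
      moreover have "l z > j + 2" if "z \<in> S" "E z w" for z
        using level_step[OF that(2)] gap[OF that(1)] False by simp
      moreover have "l w > j + 2" if "w \<in> S" using gap[OF that] False by simp
      ultimately show ?thesis unfolding level_ball_def by fastforce
    qed
  qed
  then show False using exchange[OF S(1,2) S'(1) le] by blast
qed

text \<open>Each step shrinks \<open>d - j\<close>; once \<open>j + 2 > d\<close>, the chain
  \<open>d + 1 \<le> j + 2 \<le> 2 * card S \<le> 2 * (k - 1)\<close> applies.\<close>

lemma sufficient_bound: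
  assumes "sufficient j S"
    and weak: "\<And>v u. v \<in> V \<Longrightarrow> u \<in> V \<Longrightarrow> u \<noteq> v \<Longrightarrow> critical_vertex v \<or> bicritical_pair v u"
  shows "d + 3 \<le> 2 * k"
  using assms(1)
proof (induction "d - j" arbitrary: j S rule: less_induct)
  case less
  show ?case
  proof (cases "j + 2 \<le> d")
    case True
    obtain S' where "sufficient (j + 2) S'"
      using sufficient_step[OF less.prems True weak] by blast
    then show ?thesis using less.hyps[of "j + 2" S'] True by simp
  next
    case False
    have S: "S \<subseteq> V" "card S < k" "j + 2 \<le> 2 * card (S \<inter> level_ball j)"
      using less.prems unfolding sufficient_def by auto
    have "card (S \<inter> level_ball j) \<le> card S" using card_split[OF S(1), of j] by simp
    then show ?thesis using S False by linarith
  qed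
qed

text \<open>Criticality witnesses are tested with \<open>j = 2\<close> and \<open>j = 4\<close>. If
  all fail, \<open>x\<close> is alone in the ball of radius 2, so \<open>v2\<close>, out of reach of
  \<open>x\<close>, needs a dominator in layer 3; this is contradictory.\<close>

lemma sufficient_exists:
  assumes crit: "\<And>v. v \<in> V \<Longrightarrow> 1 \<le> l v \<Longrightarrow> l v \<le> 3 \<Longrightarrow> critical_vertex v"
    and v12: "v1 \<in> V" "v2 \<in> V" "v1 \<noteq> v2" "l v1 = 2" "l v2 = 2"
  shows "\<exists>j S. sufficient j S"
proof (rule ccontr)
  assume none: "\<nexists>j S. sufficient j S"
  \<comment> \<open>\<open>S\<close> has a single vertex \<open>a\<close> in the ball of radius 2. If \<open>a \<noteq> x\<close>, then \<open>a\<close> dominates the whole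
    ball of radius 1, which contradicts the criticality of \<open>a\<close>: the witness \<open>T\<close> for \<open>a\<close> must meet that
    ball in order to dominate \<open>x\<close>, and then it also dominates \<open>a\<close>.\<close>
  have centre: "S \<inter> level_ball 2 = {x}"
    if S: "S \<subseteq> V" "card S < k" and v: "v \<in> V" "l v = 2 \<or> l v = 3"
      and domS: "dominates_on E S (V - {v})" for S v
  proof -
    have fin: "finite S" using S finite_V finite_subset by blast
    \<comment> \<open>The deleted vertex lies within radius 3, so failure for \<open>j = 2\<close>
      leaves at most one vertex in the ball of radius 2.\<close>
    have "dominates_on E S (V - level_ball (Suc 2))"
      using v by (intro dominates_on_subset[OF domS]) (auto simp: level_ball_def)
    then have "\<not> 2 + 2 \<le> 2 * card (S \<inter> level_ball 2)" using none S unfolding sufficient_def by blast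
    then have "card (S \<inter> level_ball 2) \<le> Suc 0" by simp
    then have uniq: "a = b" if "a \<in> S \<inter> level_ball 2" "b \<in> S \<inter> level_ball 2" for a b
      using that fin by (simp add: card_le_Suc0_iff_eq)
    have lx: "l x = 0" using level_0 root_in by simp
    have "x \<in> V - {v}" using v lx root_in by auto
    then have "x \<in> S \<or> (\<exists>u \<in> S. E u x)" by (rule dominates_onD[OF domS])
    then obtain a where a: "a \<in> S" "a = x \<or> E a x" by blast
    have la: "l a \<le> 1" using a(2) level_step' lx by force
    have S2: "S \<inter> level_ball 2 = {a}" using a(1) la uniq S(1) unfolding level_ball_def by auto
    then have near: "u = a" if "u \<in> S" "l u \<le> 2" for u
      using that S(1) unfolding level_ball_def by blast
    have "a = x"
    proof (rule ccontr)
      assume "a \<noteq> x"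
      then have aV: "a \<in> V" and "l a = 1" using a S(1) la level_0[of a] by force+
      then have crit_a: "critical_vertex a" using crit[OF aV] by simp
      obtain T where T: "T \<subseteq> V" "card T < k"
          "dominates_on E T (V - {a})" "a \<notin> T" "\<forall>u \<in> T. \<not> E u a"
        by (rule critical_witness[OF crit_a aV])
      have Exa: "E x a" using level_1[OF aV \<open>l a = 1\<close>] .
      moreover have "x \<in> T \<or> (\<exists>u \<in> T. E u x)"
        using root_in \<open>a \<noteq> x\<close> by (intro dominates_onD[OF T(3)]) simp
      ultimately obtain b where b: "b \<in> T" "E b x" using T(5) by blast
      have bV: "b \<in> V" using b T(1) by blast
      have "b \<noteq> x" using T(5) Exa b by blast
      then have "l b = 1" using level_step'[OF b(2)] lx level_0[OF bV] by simp
      then have "b \<in> V - {v}" using v bV by auto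
      then have "b \<in> S \<or> (\<exists>u \<in> S. E u b)" by (rule dominates_onD[OF domS])
      moreover have "u = a" if "u \<in> S" "E u b" for u
        using near[OF that(1)] level_step'[OF that(2)] \<open>l b = 1\<close> by simp
      moreover have "b = a" if "b \<in> S" using near[OF that] \<open>l b = 1\<close> by simp
      ultimately have "b = a \<or> E a b" by blast
      then show False using T(4,5) b(1) sym[of a b] by blast
    qed
    then show ?thesis using S2 by simp
  qed
  have lx: "l x = 0" using level_0 root_in by simp
  have crit_v1: "critical_vertex v1" using crit[OF v12(1)] v12(4) by simp
  obtain S where S: "S \<subseteq> V" "card S < k"
      "dominates_on E S (V - {v1})" "v1 \<notin> S" "\<forall>u \<in> S. \<not> E u v1"
    by (rule critical_witness[OF crit_v1 v12(1)])
  have S2: "S \<inter> level_ball 2 = {x}" using centre[OF S(1,2) v12(1) _ S(3)] v12 by blast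
  have finS: "finite S" using S finite_V finite_subset by blast
  have gap: "w = x \<or> l w \<ge> 3" if "w \<in> S" for w
    using S2 that S(1) unfolding level_ball_def by force
  obtain b where b: "b \<in> S" "E b v2"
    using dominates_onD[OF S(3), of v2] v12 gap[of v2] lx by auto
  have bV: "b \<in> V" using b S by blast
  have "b \<noteq> x" using level_step[OF b(2)] v12 lx by auto
  then have lb: "l b = 3" using gap[OF b(1)] level_step'[OF b(2)] v12 by auto
  \<comment> \<open>Failure for \<open>j = 4\<close> allows at most two vertices in the ball of
    radius 4, and \<open>x\<close> and \<open>b\<close> are two already.\<close>
  have "dominates_on E S (V - level_ball (Suc 4))"
    using v12 by (intro dominates_on_subset[OF S(3)]) (auto simp: level_ball_def)
  then have "\<not> 4 + 2 \<le> 2 * card (S \<inter> level_ball 4)" using none S unfolding sufficient_def by blast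
  then have "card (S \<inter> level_ball 4) \<le> card {x, b}" using \<open>b \<noteq> x\<close> by simp
  moreover have "{x, b} \<subseteq> S \<inter> level_ball 4" using S2 b(1) bV lb unfolding level_ball_def by auto
  ultimately have S4: "S \<inter> level_ball 4 = {x, b}" using finS by (metis card_seteq finite_Int)
  then have near4: "u = x \<or> u = b" if "u \<in> S" "l u \<le> 4" for u
    using that S(1) unfolding level_ball_def by blast
  \<comment> \<open>\<open>S\<close> has no vertex in layers 2 and 4, so \<open>b\<close> alone dominates layer 3; the witness for \<open>b\<close> needs
    a vertex of layer 3 to dominate \<open>v2\<close>, and this vertex dominates \<open>b\<close>.\<close>
  have b_dom: "w = b \<or> E b w" if w: "w \<in> V" "l w = 3" for w
  proof -
    have "u = b" if "u \<in> S" "E u w" for u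
      using near4[OF that(1)] level_step'[OF that(2)] level_step[OF that(2)] w(2) lx by auto
    moreover have "w = b" if "w \<in> S" using near4[OF that] w(2) lx by auto
    moreover have "w \<noteq> v1" using w(2) v12(4) by auto
    ultimately show ?thesis using dominates_onD[OF S(3), of w] w(1) by blast
  qed
  have crit_b: "critical_vertex b" using crit[OF bV] lb by simp
  obtain T where T: "T \<subseteq> V" "card T < k"
      "dominates_on E T (V - {b})" "b \<notin> T" "\<forall>u \<in> T. \<not> E u b"
    by (rule critical_witness[OF crit_b bV])
  have T2: "T \<inter> level_ball 2 = {x}" using centre[OF T(1,2) bV _ T(3)] lb by blast
  have gapT: "w = x \<or> l w \<ge> 3" if "w \<in> T" for w
    using T2 that T(1) unfolding level_ball_def by force
  have "v2 \<noteq> b" "v2 \<notin> T" using v12(5) lb gapT[of v2] lx by auto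
  then obtain c where c: "c \<in> T" "E c v2" using dominates_onD[OF T(3), of v2] v12(2) by blast
  have "c \<noteq> x" using level_step[OF c(2)] v12 lx by auto
  then have "l c = 3" using gapT[OF c(1)] level_step'[OF c(2)] v12 by auto
  then have "c = b \<or> E b c" using b_dom c T(1) by blast
  then show False using T(4,5) c(1) sym[of b c] by blast
qed

lemma level_bound:
  assumes "\<And>v u. v \<in> V \<Longrightarrow> u \<in> V \<Longrightarrow> u \<noteq> v \<Longrightarrow> critical_vertex v \<or> bicritical_pair v u"
    and "\<And>v. v \<in> V \<Longrightarrow> 1 \<le> l v \<Longrightarrow> l v \<le> 3 \<Longrightarrow> critical_vertex v"
    and "v1 \<in> V" "v2 \<in> V" "v1 \<noteq> v2" "l v1 = 2" "l v2 = 2"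
  shows "d + 3 \<le> 2 * k"
proof -
  obtain j S where "sufficient j S" using sufficient_exists[OF assms(2-)] by blast
  then show ?thesis by (rule sufficient_bound[OF _ assms(1)])
qed

end

section \<open>Vertex deletion and the domination number\<close>

lemma adj_del_vert:
  "u \<rightarrow>\<^bsub>pre_digraph.del_vert G w\<^esub> v \<longleftrightarrow> u \<rightarrow>\<^bsub>G\<^esub> v \<and> u \<noteq> w \<and> v \<noteq> w"
  by (auto simp: arcs_ends_def arc_to_ends_def pre_digraph.del_vert_simps)

lemma finite_dominating_sets:
  "finite (verts H) \<Longrightarrow> finite {D. dominating_set H D}"
  by (rule finite_subset[of _ "Pow (verts H)"]) (auto simp: dominating_set_def)

lemma domination_number_le:
  assumes "finite (verts H)" "dominating_set H D"
  shows "domination_number H \<le> card D"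
  unfolding domination_number_def using assms finite_dominating_sets by (intro Min_le) auto

lemma domination_number_attained:
  assumes "finite (verts H)"
  obtains D where "dominating_set H D" "card D = domination_number H"
proof -
  have "dominating_set H (verts H)" unfolding dominating_set_def by simp
  then have "domination_number H \<in> card ` {D. dominating_set H D}"
    unfolding domination_number_def using assms finite_dominating_sets by (intro Min_in) auto
  then show ?thesis using that by auto
qed

section \<open>Distance as the length of a shortest walk\<close>

definition walk_dist :: "('a, 'b) pre_digraph \<Rightarrow> 'a \<Rightarrow> 'a \<Rightarrow> nat" where
  "walk_dist G u v = (LEAST n. \<exists>p. pre_digraph.awalk G u p v \<and> length p = n)"

context wf_digraph
begin

lemma walk_dist_le: "awalk u p v \<Longrightarrow> walk_dist G u v \<le> length p"
  unfolding walk_dist_def by (rule Least_le) blast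

text \<open>Without a walk the \<open>LEAST\<close> is unspecified, hence the reachability
  assumption.\<close>

lemma walk_dist_attained:
  assumes "u \<rightarrow>\<^sup>* v"
  obtains p where "awalk u p v" "length p = walk_dist G u v"
proof -
  have "\<exists>n p. awalk u p v \<and> length p = n" using assms by (auto simp: reachable_awalk)
  then have "\<exists>p. awalk u p v \<and> length p = walk_dist G u v"
    unfolding walk_dist_def by (rule LeastI_ex)
  then show ?thesis using that by blast
qed

text \<open>With unit costs a walk costs its length, and a shortest walk attains the
  infimum.\<close>

lemma graph_dist_eq_walk_dist:
  assumes "u \<rightarrow>\<^sup>* v"
  shows "graph_dist G u v = ereal (real (walk_dist G u v))"
proof -
  have cost: "awalk_cost (\<lambda>_. 1) p = real (length p)" for p by (induction p) auto
  obtain p where p: "awalk u p v" "length p = walk_dist G u v"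
    using walk_dist_attained[OF assms] .
  show ?thesis unfolding graph_dist_def \<mu>_def
  proof (rule antisym)
    show "(INF p\<in>{p. awalk u p v}. ereal (awalk_cost (\<lambda>_. 1) p)) \<le> ereal (real (walk_dist G u v))"
      using p by (intro INF_lower2[of p]) (auto simp: cost)
    show "ereal (real (walk_dist G u v)) \<le> (INF p\<in>{p. awalk u p v}. ereal (awalk_cost (\<lambda>_. 1) p))"
      using walk_dist_le by (intro INF_greatest) (auto simp: cost)
  qed
qed

lemma walk_dist_step:
  assumes "u \<rightarrow>\<^sup>* v" "v \<rightarrow>\<^bsub>G\<^esub> w"
  shows "walk_dist G u w \<le> Suc (walk_dist G u v)"
proof -
  obtain p where p: "awalk u p v" "length p = walk_dist G u v"
    using walk_dist_attained[OF assms(1)] .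
  obtain e where "e \<in> arcs G" "tail G e = v" "head G e = w" using assms(2) by auto
  then have "awalk u (p @ [e]) w" using p(1) by (auto simp: awalk_simps)
  then show ?thesis using walk_dist_le[of u "p @ [e]" w] p(2) by simp
qed

text \<open>Drop the last arc of a shortest walk; a shorter walk to \<open>w\<close> would give too
  short a walk to \<open>v\<close>.\<close>

lemma walk_dist_pred:
  assumes "u \<rightarrow>\<^sup>* v" "walk_dist G u v = Suc n"
  obtains w where "u \<rightarrow>\<^sup>* w" "w \<rightarrow>\<^bsub>G\<^esub> v" "walk_dist G u w = n"
proof -
  obtain p where p: "awalk u p v" "length p = Suc n"
    using walk_dist_attained[OF assms(1)] unfolding assms(2) .
  obtain q e where q: "p = q @ [e]" using p(2) by (cases p rule: rev_cases) auto
  define w where "w = tail G e"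
  have e: "awalk u q w" "e \<in> arcs G" "head G e = v"
    using p(1) unfolding q w_def by (auto simp: awalk_simps)
  have r: "u \<rightarrow>\<^sup>* w" using e(1) by (auto simp: reachable_awalk)
  have a: "w \<rightarrow>\<^bsub>G\<^esub> v" unfolding w_def using e by (auto intro: in_arcs_imp_in_arcs_ends)
  have "walk_dist G u w \<le> n" using walk_dist_le[OF e(1)] p(2) q by simp
  then have "walk_dist G u w = n" using walk_dist_step[OF r a] assms(2) by simp
  then show ?thesis using that r a by blast
qed

lemma walk_dist_eq_0_iff:
  assumes "u \<rightarrow>\<^sup>* v"
  shows "walk_dist G u v = 0 \<longleftrightarrow> v = u"
proof
  assume dist: "walk_dist G u v = 0"
  obtain p where "awalk u p v" "length p = walk_dist G u v"
    using walk_dist_attained[OF assms] .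
  then show "v = u" using dist by (auto simp: awalk_simps)
next
  assume "v = u"
  then have "awalk u [] v" using assms by (auto simp: awalk_simps reachable_in_verts)
  then show "walk_dist G u v = 0" using walk_dist_le[of u "[]" v] by simp
qed

lemma walk_dist_levels:
  assumes "u \<rightarrow>\<^sup>* v" "i \<le> walk_dist G u v"
  shows "\<exists>w. u \<rightarrow>\<^sup>* w \<and> walk_dist G u w = i"
  using assms(2,1)
proof (induction "walk_dist G u v - i" arbitrary: v)
  case 0
  then show ?case by auto
next
  case (Suc m)
  then obtain n where n: "walk_dist G u v = Suc n" by (cases "walk_dist G u v") auto
  obtain w where "u \<rightarrow>\<^sup>* w" "walk_dist G u w = n" using walk_dist_pred[OF Suc.prems(2) n] .
  then show ?case using Suc.hyps(1)[of w] Suc.hyps(2) n by simp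
qed

end

section \<open>Levels around a diametrical vertex of a weak bicritical graph\<close>

theorem theorem3p1:
  fixes G :: "('a, 'b) pre_digraph" and k :: nat and x :: 'a
  assumes "k \<ge> 3"
    and "graph G"
    and "Digraph_Component.connected G"
    and "weak_k_bicritical k G"
    and "diametrical G x"
    and "(\<Union>i \<in> {1..3}. dist_layer G i x) \<subseteq> V_minus G"
    and "card (dist_layer G 2 x) \<ge> 2"
  shows "graph_diam G \<le> ereal (2 * real k - 3)"
proof -
  interpret graph G by (rule assms(2))
  have x: "x \<in> verts G" and diam: "graph_diam G = (SUP y \<in> verts G. graph_dist G x y)"
    using assms(5) unfolding diametrical_def by auto
  have weak: "weak_bicritical G" and k: "domination_number G = k"
    using assms(4) unfolding weak_k_bicritical_def by auto
  have "strongly_connected G"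
    using symmetric_connected_imp_strongly_connected[OF sym_arcs assms(3)] .
  then have reach: "x \<rightarrow>\<^sup>*\<^bsub>G\<^esub> v" if "v \<in> verts G" for v
    using that x unfolding strongly_connected_def by blast
  have dist: "graph_dist G x v = ereal (real (walk_dist G x v))" if "v \<in> verts G" for v
    using graph_dist_eq_walk_dist reach that by blast
  have layer: "dist_layer G i x = {v \<in> verts G. walk_dist G x v = i}" for i
    unfolding dist_layer_def using dist by auto
  have "finite (verts G)" by simp
  have "\<not> card (dist_layer G 2 x) \<le> Suc 0" using assms(7) by simp
  then obtain v1 v2 where v12: "v1 \<in> dist_layer G 2 x" "v2 \<in> dist_layer G 2 x" "v1 \<noteq> v2"
    using \<open>finite (verts G)\<close> by (auto simp: layer card_le_Suc0_iff_eq)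
  \<comment> \<open>The level structure is set up anew for each \<open>y\<close>, whose distance
    serves as \<open>d\<close>.\<close>
  have bound: "walk_dist G x y + 3 \<le> 2 * k" if y: "y \<in> verts G" for y
  proof -
    interpret layered_graph "verts G" "\<lambda>u v. u \<rightarrow>\<^bsub>G\<^esub> v" "walk_dist G x" x "walk_dist G x y" k
    proof unfold_locales
      show "finite (verts G)" by simp
      show "v \<rightarrow>\<^bsub>G\<^esub> u" if "u \<rightarrow>\<^bsub>G\<^esub> v" for u v using that graph_symmetric by blast
      show "walk_dist G x v \<le> Suc (walk_dist G x u)" if "u \<rightarrow>\<^bsub>G\<^esub> v" for u v
        using that walk_dist_step reach adj_in_verts by blast
      show "x \<in> verts G" by (rule x)
      show "walk_dist G x v = 0 \<longleftrightarrow> v = x" if "v \<in> verts G" for v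
        using walk_dist_eq_0_iff[OF reach[OF that]] .
      show "x \<rightarrow>\<^bsub>G\<^esub> v" if v: "v \<in> verts G" "walk_dist G x v = 1" for v
      proof -
        have "walk_dist G x v = Suc 0" using v(2) by simp
        then obtain w where w: "x \<rightarrow>\<^sup>*\<^bsub>G\<^esub> w" "w \<rightarrow>\<^bsub>G\<^esub> v" "walk_dist G x w = 0"
          using walk_dist_pred[OF reach[OF v(1)]] by blast
        then show ?thesis using walk_dist_eq_0_iff[OF w(1)] by simp
      qed
      show "\<exists>v \<in> verts G. walk_dist G x v = i" if "i \<le> walk_dist G x y" for i
        using walk_dist_levels[OF reach[OF y] that] reachable_in_verts by blast
      show "k \<le> card D" if "D \<subseteq> verts G" "dominates_on (\<lambda>u v. u \<rightarrow>\<^bsub>G\<^esub> v) D (verts G)" for D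
        using that domination_number_le[of G D] k
        unfolding dominating_set_def dominates_on_def by auto
    qed
    have crit: "critical_vertex v" if "v \<in> V_minus G" for v
    proof -
      have fin: "finite (verts (pre_digraph.del_vert G v))" by (simp add: pre_digraph.verts_del_vert)
      obtain D where "dominating_set (pre_digraph.del_vert G v) D"
          "card D = domination_number (pre_digraph.del_vert G v)"
        using domination_number_attained[OF fin] .
      then show ?thesis using that k
        unfolding critical_vertex_def V_minus_def dominating_set_def dominates_on_def
        by (intro exI[of _ D]) (auto simp: pre_digraph.verts_del_vert adj_del_vert)
    qed
    \<comment> \<open>As \<open>V_plus G\<close> is empty, \<open>v\<close> is in
      \<open>V_minus G\<close> or in \<open>V_zero G\<close>; in the latter case the graph without
      \<open>v\<close> is critical, so deleting \<open>u\<close> as well lowers the number.\<close>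
    have "critical_vertex v \<or> bicritical_pair v u"
      if vu: "v \<in> verts G" "u \<in> verts G" "u \<noteq> v" for v u
    proof (cases "v \<in> V_zero G")
      case True
      define H where "H = pre_digraph.del_vert G v"
      have H: "domination_number H = k" "critical H"
        using True weak k unfolding H_def V_zero_def weak_bicritical_def by auto
      have "u \<in> V_minus H" using H(2) vu unfolding critical_def H_def by (auto simp: pre_digraph.verts_del_vert)
      then have less: "domination_number (pre_digraph.del_vert H u) < k"
        using H(1) unfolding V_minus_def by simp
      have fin: "finite (verts (pre_digraph.del_vert H u))"
        unfolding H_def by (simp add: pre_digraph.verts_del_vert)
      obtain D where "dominating_set (pre_digraph.del_vert H u) D"
          "card D = domination_number (pre_digraph.del_vert H u)"
        using domination_number_attained[OF fin] .
      then have "bicritical_pair v u" using less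
        unfolding bicritical_pair_def dominating_set_def dominates_on_def H_def
        by (intro exI[of _ D]) (auto simp: pre_digraph.verts_del_vert adj_del_vert)
      then show ?thesis ..
    next
      case False
      then have "v \<in> V_minus G" using weak vu(1)
        unfolding weak_bicritical_def V_plus_def V_minus_def V_zero_def by force
      then show ?thesis using crit by blast
    qed
    moreover have "critical_vertex v"
      if "v \<in> verts G" "1 \<le> walk_dist G x v" "walk_dist G x v \<le> 3" for v
      using that assms(6) by (intro crit) (auto simp: layer)
    ultimately show ?thesis using v12 by (intro level_bound[of v1 v2]) (auto simp: layer)
  qed
  \<comment> \<open>Since \<open>x\<close> is diametrical, it suffices to bound the distances from
    \<open>x\<close>.\<close>
  show ?thesis unfolding diam
  proof (rule SUP_least)
    fix y assume y: "y \<in> verts G"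
    have "real (walk_dist G x y) \<le> 2 * real k - 3" using bound[OF y] by linarith
    then show "graph_dist G x y \<le> ereal (2 * real k - 3)" using dist[OF y] by simp
  qed
qed

end
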